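(* Let $G=G(I,P;E)$ be an arbitrary Assur graph. Then there is a configuration $\mathbf p$ of $I\cup P$ in $\mathbb R^2$ (with distinct positions for the pinned vertices) such that: (1) the pinned framework $G(\mathbf p)$ has a one-dimensional space of self-stresses, spanned by a self-stress which is non-zero on every edge; and (2) $G(\mathbf p)$ has, up to scalar multiples, a unique non-trivial first-order motion (with the pinned vertices fixed), and this motion assigns a non-zero velocity to every inner vertex.
   Context: A pinned graph $G(I,P;E)$ has a set $I$ of inner vertices, a set $P$ of pinned vertices, and edge set $E$ in which every edge has at least one endpoint in $I$. A pinned framework $G(\mathbf p)$ places all vertices at points of $\mathbb R^2$, pinned vertices regarded as fixed. A first-order motion assigns $\mathbf p'_i\in\mathbb R^2$ to inner vertices ($\mathbf p'_v=\mathbf 0$ for $v\in P$) with $(\mathbf p_i-\mathbf p_j)\cdot(\mathbf p'_i-\mathbf p'_j)=0$ for all edges $ij$. A self-stress is an assignment of scalars $\lambda_{ij}$ to edges with $\sum_{j:ij\in E}\lambda_{ij}(\mathbf p_i-\mathbf p_j)=\mathbf 0$ at every inner vertex $i$ (a row dependency of the $|E|\times 2|I|$ pinned rigidity matrix). Pinned Framework Conditions: $|E|=2|I|$ and for every subgraph $G'(I',P';E')$ with $E'\ne\emptyset$: $|E'|\le 2|I'|$ if $|P'|\ge2$, $|E'|\le 2|I'|-1$ if $|P'|=1$, $|E'|\le 2|I'|-3$ if $P'=\emptyset$; graphs satisfying these are called pinned isostatic. A rigidity circuit is a (multi)graph with edge set $C$, $|C|=2|V(C)|-2$, and every nonempty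 proper subset $F$ satisfies $|F|\le 2|V(F)|-3$. An Assur graph is a pinned isostatic graph such that identifying all pinned vertices to a single vertex (keeping all edges) yields a rigidity circuit. *)

theory Defs
  imports "HOL-Analysis.Analysis"
begin

definition pinned_graph :: "'v set \<Rightarrow> 'v set \<Rightarrow> 'v set set \<Rightarrow> bool" where
  "pinned_graph I P E \<longleftrightarrow> finite I \<and> finite P \<and> I \<inter> P = {} \<and> finite E \<and>
     (\<forall>e\<in>E. card e = 2 \<and> e \<subseteq> I \<union> P \<and> e \<inter> I \<noteq> {})"

definition pinned_subgraph :: "'v set \<Rightarrow> 'v set \<Rightarrow> 'v set set \<Rightarrow>
    'v set \<Rightarrow> 'v set \<Rightarrow> 'v set set \<Rightarrow> bool" where
  "pinned_subgraph I' P' E' I P E \<longleftrightarrow> I' \<subseteq> I \<and> P' \<subseteq> P \<and> E' \<subseteq> E \<and>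
     (\<forall>e\<in>E'. e \<subseteq> I' \<union> P')"

definition pinned_isostatic :: "'v set \<Rightarrow> 'v set \<Rightarrow> 'v set set \<Rightarrow> bool" where
  "pinned_isostatic I P E \<longleftrightarrow> pinned_graph I P E \<and> card E = 2 * card I \<and>
     (\<forall>I' P' E'. pinned_subgraph I' P' E' I P E \<and> E' \<noteq> {} \<longrightarrow>
        (card P' \<ge> 2 \<longrightarrow> int (card E') \<le> 2 * int (card I')) \<and>
        (card P' = 1 \<longrightarrow> int (card E') \<le> 2 * int (card I') - 1) \<and>
        (P' = {} \<longrightarrow> int (card E') \<le> 2 * int (card I') - 3))"

text \<open>Rigidity circuit for a multigraph given by an edge index set C and an
  endpoint map (edge \<Rightarrow> set of its endpoints).  V(F) is the vertex set spanned by F.\<close>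
definition mg_vertices :: "('e \<Rightarrow> 'w set) \<Rightarrow> 'e set \<Rightarrow> 'w set" where
  "mg_vertices ends F = \<Union> (ends ` F)"

definition rigidity_circuit :: "'e set \<Rightarrow> ('e \<Rightarrow> 'w set) \<Rightarrow> bool" where
  "rigidity_circuit C ends \<longleftrightarrow> finite C \<and> (\<forall>e\<in>C. finite (ends e) \<and> ends e \<noteq> {}) \<and>
     int (card C) = 2 * int (card (mg_vertices ends C)) - 2 \<and>
     (\<forall>F. F \<subseteq> C \<and> F \<noteq> {} \<and> F \<noteq> C \<longrightarrow>
        int (card F) \<le> 2 * int (card (mg_vertices ends F)) - 3)"

definition identify_pins :: "'v set \<Rightarrow> 'v \<Rightarrow> 'v option" where
  "identify_pins P v = (if v \<in> P then None else Some v)"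

definition assur_graph :: "'v set \<Rightarrow> 'v set \<Rightarrow> 'v set set \<Rightarrow> bool" where
  "assur_graph I P E \<longleftrightarrow> pinned_isostatic I P E \<and>
     rigidity_circuit E (\<lambda>e. identify_pins P ` e)"

definition first_order_motion :: "'v set \<Rightarrow> 'v set \<Rightarrow> 'v set set \<Rightarrow>
    ('v \<Rightarrow> real^2) \<Rightarrow> ('v \<Rightarrow> real^2) \<Rightarrow> bool" where
  "first_order_motion I P E p q \<longleftrightarrow> (\<forall>v. v \<notin> I \<longrightarrow> q v = 0) \<and>
     (\<forall>i j. {i, j} \<in> E \<longrightarrow> (p i - p j) \<bullet> (q i - q j) = 0)"

definition self_stress :: "'v set \<Rightarrow> 'v set \<Rightarrow> 'v set set \<Rightarrow>
    ('v \<Rightarrow> real^2) \<Rightarrow> ('v set \<Rightarrow> real) \<Rightarrow> bool" where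
  "self_stress I P E p w \<longleftrightarrow> (\<forall>e. e \<notin> E \<longrightarrow> w e = 0) \<and>
     (\<forall>i\<in>I. (\<Sum>j\<in>{j. {i, j} \<in> E}. w {i, j} *\<^sub>R (p i - p j)) = 0)"

end

theory Submission
  imports Defs "HOL-Computational_Algebra.Polynomial"
begin

text \<open>
  Put all pins at the origin. The Assur graph becomes a rigidity circuit, so for a generic position
  \<open>x\<close> of the inner vertices every set of all but one of the edges has independent rows
  (Laman's theorem). The only motion of the inner vertices is then the rotation \<open>q = perp x\<close>, which
  is non-zero at every inner vertex.

  To separate the pins, use that the condition \<open>(p i - p j) \<bullet> (q i - q j) = 0\<close> is linear in \<open>p\<close> when
  \<open>q\<close> is kept fixed. The pin positions \<open>r\<close> that extend to a solution of this system form a subspace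
  of codimension at most one, so there is a solution \<open>r\<close> with distinct pins. Every \<open>p = x + \<tau> r\<close>
  still has the motion \<open>q\<close>, and for all but finitely many \<open>\<tau>\<close> the independence of all but one of the
  rows survives, which makes both the motion and the self-stress unique and forces the latter to be
  non-zero on every edge.

  Laman's theorem is obtained by prescribing generic edge directions instead of positions: a frame
  matrix of a graph with \<open>|F| \<le> 2|V(F)| - 2\<close> for all edge sets \<open>F\<close> has independent rows, since in a
  minimal counterexample the kernel would be constant on connected components.
\<close>

section \<open>Linear systems with vector-valued entries\<close>

text \<open>Gaussian elimination, one equation per induction step: an unknown \<open>k0\<close> that
  occurs in the equation \<open>c\<close> is eliminated from the others, and its value is read off
  from \<open>c\<close> at the end.\<close>

lemma homogeneous_system_nontrivial_solution:
  fixes A :: "'c \<Rightarrow> 'k \<Rightarrow> real"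
  assumes "finite C" "finite K" "card C < card K"
  shows "\<exists>x. (\<exists>k\<in>K. x k \<noteq> 0) \<and> (\<forall>c\<in>C. (\<Sum>k\<in>K. A c k * x k) = 0)"
  using assms
proof (induction C arbitrary: K A rule: finite_induct)
  case empty
  then obtain k where "k \<in> K" by fastforce
  then show ?case by (intro exI[of _ "\<lambda>_. 1"]) auto
next
  case (insert c C)
  show ?case
  proof (cases "\<forall>k\<in>K. A c k = 0")
    case True
    then show ?thesis using insert.IH[of K A] insert.prems insert.hyps by auto
  next
    case False
    then obtain k0 where k0: "k0 \<in> K" "A c k0 \<noteq> 0" by blast
    define B where "B = (\<lambda>f k. A f k - A f k0 * A c k / A c k0)"
    have "card C < card (K - {k0})" using insert k0 by (simp add: card_Diff_singleton)
    then obtain x where x: "\<exists>k\<in>K-{k0}. x k \<noteq> 0" "\<forall>f\<in>C. (\<Sum>k\<in>K-{k0}. B f k * x k) = 0"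
      using insert.IH[of "K - {k0}" B] insert.prems by auto
    define s where "s = (\<Sum>k\<in>K-{k0}. A c k * x k)"
    define y where "y = x(k0 := - s / A c k0)"
    have sum_y: "(\<Sum>k\<in>K. A f k * y k) = (\<Sum>k\<in>K-{k0}. A f k * x k) - A f k0 * s / A c k0" for f
    proof -
      have "(\<Sum>k\<in>K. A f k * y k) = A f k0 * y k0 + (\<Sum>k\<in>K-{k0}. A f k * y k)"
        using k0 insert.prems by (intro sum.remove) auto
      also have "(\<Sum>k\<in>K-{k0}. A f k * y k) = (\<Sum>k\<in>K-{k0}. A f k * x k)"
        by (intro sum.cong) (auto simp: y_def)
      finally show ?thesis by (simp add: y_def)
    qed
    have "(\<Sum>k\<in>K. A f k * y k) = 0" if "f \<in> insert c C" for f
    proof (cases "f = c")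
      case True
      then show ?thesis using k0 by (simp add: sum_y s_def[symmetric])
    next
      case False
      with that x(2) have "0 = (\<Sum>k\<in>K-{k0}. B f k * x k)" by auto
      also have "\<dots> = (\<Sum>k\<in>K-{k0}. A f k * x k - (A f k0 / A c k0) * (A c k * x k))"
        by (intro sum.cong) (auto simp: B_def algebra_simps)
      also have "\<dots> = (\<Sum>k\<in>K. A f k * y k)"
        unfolding sum_y by (simp only: sum_subtractf sum_distrib_left[symmetric] s_def) simp
      finally show ?thesis by simp
    qed
    moreover have "\<exists>k\<in>K. y k \<noteq> 0" using x(1) by (auto simp: y_def)
    ultimately show ?thesis by blast
  qed
qed

text \<open>
  A matrix has rows indexed by \<open>C\<close> and columns indexed by \<open>K\<close>, with vector-valued entries;
  over a Euclidean space \<open>'a\<close> it thus has \<open>DIM('a) * card K\<close> scalar columns.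
\<close>

definition row_indep :: "'k set \<Rightarrow> 'c set \<Rightarrow> ('c \<Rightarrow> 'k \<Rightarrow> 'a::real_vector) \<Rightarrow> bool" where
  "row_indep K C A \<longleftrightarrow>
     (\<forall>w::'c \<Rightarrow> real. (\<forall>k\<in>K. (\<Sum>c\<in>C. w c *\<^sub>R A c k) = 0) \<longrightarrow> (\<forall>c\<in>C. w c = 0))"

lemma row_indepI:
  assumes "\<And>w c. \<lbrakk>\<And>k. k \<in> K \<Longrightarrow> (\<Sum>c\<in>C. w c *\<^sub>R A c k) = 0; c \<in> C\<rbrakk> \<Longrightarrow> w c = 0"
  shows "row_indep K C A"
  using assms unfolding row_indep_def by blast

lemma row_indepD:
  assumes "row_indep K C A" "\<And>k. k \<in> K \<Longrightarrow> (\<Sum>c\<in>C. w c *\<^sub>R A c k) = 0" "c \<in> C"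
  shows "w c = 0"
  using assms unfolding row_indep_def by blast

lemma row_indep_subset:
  assumes "row_indep K C A" "D \<subseteq> C" "finite C"
  shows "row_indep K D A"
proof (rule row_indepI)
  fix w :: "_ \<Rightarrow> real" and c
  assume w: "\<And>k. k \<in> K \<Longrightarrow> (\<Sum>c\<in>D. w c *\<^sub>R A c k) = 0" and c: "c \<in> D"
  define u where "u = (\<lambda>c. if c \<in> D then w c else 0)"
  have "(\<Sum>c\<in>C. u c *\<^sub>R A c k) = (\<Sum>c\<in>D. w c *\<^sub>R A c k)" for k
    using assms(2,3) by (intro sum.mono_neutral_cong_right) (auto simp: u_def)
  then have "u c = 0" using row_indepD[OF assms(1), of u c] w c assms(2) by auto
  then show "w c = 0" using c by (simp add: u_def)
qed

lemma row_indep_row_nonzero: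
  assumes "row_indep K C A" "c \<in> C"
  shows "\<exists>k\<in>K. A c k \<noteq> 0"
proof (rule ccontr)
  assume "\<not> ?thesis"
  then have "(\<Sum>b\<in>C. of_bool (b = c) *\<^sub>R A b k) = 0" if "k \<in> K" for k
    using that by (intro sum.neutral) auto
  from row_indepD[OF assms(1) this assms(2)] show False by simp
qed

lemma row_indep_rescale:
  assumes "row_indep K C (\<lambda>c k. a c *\<^sub>R A c k)" "\<And>c. c \<in> C \<Longrightarrow> a c \<noteq> 0"
  shows "row_indep K C A"
proof (rule row_indepI)
  fix w :: "_ \<Rightarrow> real" and c
  assume w: "\<And>k. k \<in> K \<Longrightarrow> (\<Sum>c\<in>C. w c *\<^sub>R A c k) = 0" and c: "c \<in> C"
  have "(\<Sum>c\<in>C. (w c / a c) *\<^sub>R a c *\<^sub>R A c k) = (\<Sum>c\<in>C. w c *\<^sub>R A c k)" for k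
    using assms(2) by (intro sum.cong) auto
  then have "w c / a c = 0" using row_indepD[OF assms(1), of "\<lambda>c. w c / a c" c] w c by simp
  then show "w c = 0" using assms(2)[OF c] by simp
qed

text \<open>Exchanging the two sums pairs a dependency with a vector \<open>x\<close>. If
  \<open>x\<close> is orthogonal to all rows but one, that row either has coefficient zero or is
  orthogonal to \<open>x\<close> too.\<close>

lemma row_dependency_inner:
  fixes A :: "'c \<Rightarrow> 'k \<Rightarrow> 'a::real_inner"
  assumes "\<And>k. k \<in> K \<Longrightarrow> (\<Sum>c\<in>C. w c *\<^sub>R A c k) = 0"
  shows "(\<Sum>c\<in>C. w c * (\<Sum>k\<in>K. A c k \<bullet> x k)) = 0"
proof -
  have "(\<Sum>c\<in>C. w c * (\<Sum>k\<in>K. A c k \<bullet> x k)) = (\<Sum>k\<in>K. (\<Sum>c\<in>C. w c *\<^sub>R A c k) \<bullet> x k)"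
    by (simp add: inner_sum_left sum_distrib_left) (rule sum.swap)
  then show ?thesis using assms by simp
qed

lemma row_indep_remove_dependency_zero:
  assumes "finite C" "row_indep K (C - {e}) A" "\<And>k. k \<in> K \<Longrightarrow> (\<Sum>c\<in>C. w c *\<^sub>R A c k) = 0"
    "w e = 0" "c \<in> C"
  shows "w c = 0"
proof (cases "c = e")
  case False
  have "(\<Sum>c\<in>C-{e}. w c *\<^sub>R A c k) = (\<Sum>c\<in>C. w c *\<^sub>R A c k)" for k
    using assms(1,4) by (intro sum.mono_neutral_left) auto
  then show ?thesis using row_indepD[OF assms(2), of w c] assms(3,5) False by simp
qed (use assms in simp)

text \<open>A dependency that vanishes on one row is a dependency of the remaining rows, hence zero.
  This makes every coefficient of \<open>w\<close> non-zero, and any other dependency minus the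
  multiple of \<open>w\<close> that agrees with it at \<open>b\<close> must vanish.\<close>

lemma row_dependency_of_circuit:
  assumes "finite C" "C \<noteq> {}" and dep: "\<not> row_indep K C A"
    and ind: "\<And>c. c \<in> C \<Longrightarrow> row_indep K (C - {c}) A"
  obtains w where "\<forall>c. c \<notin> C \<longrightarrow> w c = 0" "\<forall>k\<in>K. (\<Sum>c\<in>C. w c *\<^sub>R A c k) = 0"
    "\<forall>c\<in>C. w c \<noteq> 0"
    "\<And>u. \<forall>c. c \<notin> C \<longrightarrow> u c = 0 \<Longrightarrow> \<forall>k\<in>K. (\<Sum>c\<in>C. u c *\<^sub>R A c k) = 0 \<Longrightarrow>
       \<exists>a. u = (\<lambda>c. a * w c)"
proof -
  obtain v b where v: "\<forall>k\<in>K. (\<Sum>c\<in>C. v c *\<^sub>R A c k) = 0" "b \<in> C" "v b \<noteq> 0"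
    using dep unfolding row_indep_def by blast
  define w where "w = (\<lambda>c. if c \<in> C then v c else 0)"
  have w: "\<forall>k\<in>K. (\<Sum>c\<in>C. w c *\<^sub>R A c k) = 0" using v(1) by (simp add: w_def cong: sum.cong)
  have nz: "w c \<noteq> 0" if "c \<in> C" for c
  proof
    assume "w c = 0"
    then have "w b = 0"
      using row_indep_remove_dependency_zero[OF assms(1) ind[OF that], of w b] w v(2) by blast
    then show False using v by (simp add: w_def)
  qed
  show ?thesis
  proof (rule that[of w])
    fix u assume u: "\<forall>c. c \<notin> C \<longrightarrow> u c = 0" "\<forall>k\<in>K. (\<Sum>c\<in>C. u c *\<^sub>R A c k) = 0"
    define a where "a = u b / w b"
    have "(\<Sum>c\<in>C. (u c - a * w c) *\<^sub>R A c k) = 0" if "k \<in> K" for k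
    proof -
      have "(\<Sum>c\<in>C. (u c - a * w c) *\<^sub>R A c k) =
          (\<Sum>c\<in>C. u c *\<^sub>R A c k) - a *\<^sub>R (\<Sum>c\<in>C. w c *\<^sub>R A c k)"
        by (simp add: scaleR_diff_left sum_subtractf scaleR_sum_right)
      then show ?thesis using u w that by simp
    qed
    then have "u c - a * w c = 0" if "c \<in> C" for c
      using row_indep_remove_dependency_zero[OF assms(1) ind[OF v(2)], of "\<lambda>c. u c - a * w c" c] that nz[OF v(2)]
      by (simp add: a_def)
    then have "u = (\<lambda>c. a * w c)" using u(1) by (fastforce simp: w_def)
    then show "\<exists>a. u = (\<lambda>c. a * w c)" by blast
  qed (use w nz in \<open>auto simp: w_def\<close>)
qed

lemma row_indep_linear_image:
  assumes "row_indep K C A" "linear f" "\<And>v. f v = 0 \<Longrightarrow> v = 0"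
  shows "row_indep K C (\<lambda>c k. f (A c k))"
proof (rule row_indepI)
  fix w c assume w: "\<And>k. k \<in> K \<Longrightarrow> (\<Sum>c\<in>C. w c *\<^sub>R f (A c k)) = 0" and c: "c \<in> C"
  have "f (\<Sum>c\<in>C. w c *\<^sub>R A c k) = (\<Sum>c\<in>C. w c *\<^sub>R f (A c k))" for k
    by (simp add: linear_sum[OF assms(2)] linear_scale[OF assms(2)])
  then show "w c = 0" using row_indepD[OF assms(1), of w c] w c assms(3) by simp
qed

lemma row_indep_cong:
  assumes "\<And>c k. c \<in> C \<Longrightarrow> k \<in> K \<Longrightarrow> A c k = B c k"
  shows "row_indep K C A \<longleftrightarrow> row_indep K C B"
  unfolding row_indep_def using assms by simp

lemma row_indep_coordinates:
  fixes A :: "'c \<Rightarrow> 'k \<Rightarrow> 'a::euclidean_space"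
  shows "row_indep K C A \<longleftrightarrow> row_indep (K \<times> Basis) C (\<lambda>c (k, b). A c k \<bullet> b)"
proof -
  have "(\<forall>k\<in>K. (\<Sum>c\<in>C. w c *\<^sub>R A c k) = 0) \<longleftrightarrow>
        (\<forall>k\<in>K \<times> Basis. (\<Sum>c\<in>C. w c *\<^sub>R (case k of (k, b) \<Rightarrow> A c k \<bullet> b)) = 0)" for w
    by (auto simp: euclidean_eq_iff[where 'a='a] inner_sum_left)
  then show ?thesis unfolding row_indep_def by simp
qed

section \<open>Row counts, kernels and uniqueness up to scaling\<close>

lemma row_dependent_card:
  fixes A :: "'c \<Rightarrow> 'k \<Rightarrow> 'a::euclidean_space"
  assumes "finite K" "finite C" "DIM('a) * card K < card C"
  shows "\<not> row_indep K C A"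
proof -
  have "card (K \<times> (Basis::'a set)) < card C"
    using assms by (simp add: card_cartesian_product mult.commute)
  then obtain w where "\<exists>c\<in>C. w c \<noteq> 0"
    "\<forall>k\<in>K \<times> (Basis::'a set). (\<Sum>c\<in>C. (A c (fst k) \<bullet> snd k) * w c) = 0"
    using homogeneous_system_nontrivial_solution[of "K \<times> (Basis::'a set)" C "\<lambda>k c. A c (fst k) \<bullet> snd k"] assms
    by auto
  then show ?thesis
    unfolding row_indep_def by (intro notI)
      (auto simp: mult.commute split_beta euclidean_eq_iff[where 'a='a] inner_sum_left dest!: spec[of _ w])
qed

lemma nontrivial_kernel:
  fixes A :: "'c \<Rightarrow> 'k \<Rightarrow> 'a::euclidean_space"
  assumes "finite K" "finite C" "card C < DIM('a) * card K"
  obtains x where "\<exists>k\<in>K. x k \<noteq> 0" "\<forall>k. k \<notin> K \<longrightarrow> x k = 0"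
    "\<forall>c\<in>C. (\<Sum>k\<in>K. A c k \<bullet> x k) = 0"
proof -
  have "card C < card (K \<times> (Basis::'a set))"
    using assms by (simp add: card_cartesian_product mult.commute)
  then obtain y where y: "\<exists>k\<in>K \<times> (Basis::'a set). y k \<noteq> 0"
    "\<forall>c\<in>C. (\<Sum>k\<in>K \<times> (Basis::'a set). (A c (fst k) \<bullet> snd k) * y k) = 0"
    using homogeneous_system_nontrivial_solution[of C "K \<times> (Basis::'a set)" "\<lambda>c k. A c (fst k) \<bullet> snd k"] assms
    by auto
  define x where "x = (\<lambda>k. if k \<in> K then \<Sum>b\<in>Basis. y (k, b) *\<^sub>R b else (0::'a))"
  have xb: "x k \<bullet> b = y (k, b)" if "k \<in> K" "b \<in> Basis" for k b
    using that by (simp add: x_def inner_sum_left_Basis)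
  have "(\<Sum>k\<in>K. A c k \<bullet> x k) = 0" if "c \<in> C" for c
  proof -
    have "(\<Sum>k\<in>K. A c k \<bullet> x k) = (\<Sum>k\<in>K. \<Sum>b\<in>Basis. (A c k \<bullet> b) * y (k, b))"
      by (intro sum.cong refl) (subst euclidean_inner, simp add: xb)
    also have "\<dots> = (\<Sum>k\<in>K \<times> (Basis::'a set). (A c (fst k) \<bullet> snd k) * y k)"
      by (simp add: sum.cartesian_product split_beta)
    finally show ?thesis using y(2) that by simp
  qed
  moreover have "\<exists>k\<in>K. x k \<noteq> 0"
  proof -
    obtain k b where kb: "k \<in> K" "b \<in> Basis" "y (k, b) \<noteq> 0" using y(1) by auto
    then show ?thesis using xb[OF kb(1,2)] by (metis inner_zero_left)
  qed
  ultimately show ?thesis using that[of x] by (auto simp: x_def)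
qed

text \<open>A non-zero kernel vector is orthogonal to every row, so appending it as a further row
  preserves independence. That would give more independent rows than there are scalar
  columns.\<close>

lemma row_indep_square_kernel:
  fixes A :: "'c \<Rightarrow> 'k \<Rightarrow> 'a::euclidean_space"
  assumes "finite K" "finite C" "card C = DIM('a) * card K" "row_indep K C A"
    and ker: "\<forall>c\<in>C. (\<Sum>k\<in>K. A c k \<bullet> x k) = 0" and "k \<in> K"
  shows "x k = 0"
proof (rule ccontr)
  assume "x k \<noteq> 0"
  \<comment> \<open>The new index \<open>None\<close> carries the appended row
    \<open>x\<close>.\<close>
  define C' where "C' = insert None (Some ` C)"
  define A' where "A' = (\<lambda>c. case c of None \<Rightarrow> x | Some c \<Rightarrow> A c)"
  have sum_C': "(\<Sum>c\<in>C'. g c) = g None + (\<Sum>c\<in>C. g (Some c))" for g :: "'c option \<Rightarrow> 'b::comm_monoid_add"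
    using assms(2) by (simp add: C'_def sum.reindex image_iff)
  have "row_indep K C' A'"
  proof (rule row_indepI)
    fix w c assume w: "\<And>k. k \<in> K \<Longrightarrow> (\<Sum>c\<in>C'. w c *\<^sub>R A' c k) = 0" and c: "c \<in> C'"
    have "(\<Sum>c\<in>C'. w c * (\<Sum>k\<in>K. A' c k \<bullet> x k)) = 0"
      using w by (rule row_dependency_inner)
    then have "w None * (\<Sum>k\<in>K. x k \<bullet> x k) = 0"
      using ker by (simp add: sum_C' A'_def)
    moreover have "(\<Sum>k\<in>K. x k \<bullet> x k) \<noteq> 0"
      using \<open>x k \<noteq> 0\<close> \<open>k \<in> K\<close> assms(1) by (subst sum_nonneg_eq_0_iff) auto
    ultimately have None: "w None = 0" by simp
    then have "w (Some c) = 0" if "c \<in> C" for c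
      using row_indepD[OF assms(4), of "\<lambda>c. w (Some c)"] w that by (simp add: sum_C' A'_def)
    then show "w c = 0" using None c by (auto simp: C'_def)
  qed
  moreover have "card C' = Suc (card C)"
    using assms(2) by (simp add: C'_def card_image image_iff)
  ultimately show False using row_dependent_card[of K C' A'] assms by (simp add: C'_def)
qed

text \<open>Replacing the row \<open>c0\<close> by the kernel vector \<open>x\<close> yields an
  independent square matrix, whose kernel is zero. The part of \<open>y\<close> orthogonal to
  \<open>x\<close> lies in that kernel.\<close>

lemma row_indep_almost_square_kernel:
  fixes A :: "'c \<Rightarrow> 'k \<Rightarrow> 'a::euclidean_space"
  assumes "finite K" "finite C" "card C = DIM('a) * card K" "c0 \<in> C" "row_indep K (C - {c0}) A"
    and x: "\<forall>c\<in>C-{c0}. (\<Sum>k\<in>K. A c k \<bullet> x k) = 0" and x0: "\<exists>k\<in>K. x k \<noteq> 0"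
    and y: "\<forall>c\<in>C-{c0}. (\<Sum>k\<in>K. A c k \<bullet> y k) = 0"
  obtains a where "\<forall>k\<in>K. y k = a *\<^sub>R x k"
proof -
  define n where "n = (\<Sum>k\<in>K. x k \<bullet> x k)"
  have "n \<noteq> 0" using x0 assms(1) unfolding n_def by (subst sum_nonneg_eq_0_iff) auto
  \<comment> \<open>The coefficient of the orthogonal projection of \<open>y\<close> onto
    \<open>x\<close>.\<close>
  define a where "a = (\<Sum>k\<in>K. x k \<bullet> y k) / n"
  define B where "B = A(c0 := x)"
  have split: "(\<Sum>c\<in>C. g c) = g c0 + (\<Sum>c\<in>C-{c0}. g c)" for g :: "'c \<Rightarrow> 'b::comm_monoid_add"
    using assms by (intro sum.remove) auto
  have ind: "row_indep K C B"
  proof (rule row_indepI)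
    fix w c assume w: "\<And>k. k \<in> K \<Longrightarrow> (\<Sum>c\<in>C. w c *\<^sub>R B c k) = 0" and c: "c \<in> C"
    have "(\<Sum>c\<in>C. w c * (\<Sum>k\<in>K. B c k \<bullet> x k)) = 0"
      using w by (rule row_dependency_inner)
    then have c0: "w c0 = 0"
      using x \<open>n \<noteq> 0\<close> unfolding split by (simp add: B_def n_def)
    then have "w c = 0" if "c \<in> C - {c0}" for c
      using row_indepD[OF assms(5), of w] w that unfolding split by (simp add: B_def)
    then show "w c = 0" using c0 c by auto
  qed
  have "\<forall>c\<in>C. (\<Sum>k\<in>K. B c k \<bullet> (y k - a *\<^sub>R x k)) = 0"
  proof
    fix c assume "c \<in> C"
    have "(\<Sum>k\<in>K. B c k \<bullet> (y k - a *\<^sub>R x k)) = (\<Sum>k\<in>K. B c k \<bullet> y k) - a * (\<Sum>k\<in>K. B c k \<bullet> x k)"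
      by (simp add: inner_diff_right sum_subtractf sum_distrib_left)
    also have "\<dots> = 0"
      using x y \<open>c \<in> C\<close> \<open>n \<noteq> 0\<close> by (cases "c = c0") (auto simp: B_def a_def n_def)
    finally show "(\<Sum>k\<in>K. B c k \<bullet> (y k - a *\<^sub>R x k)) = 0" .
  qed
  from row_indep_square_kernel[OF assms(1-3) ind this] show ?thesis
    using that[of a] by simp
qed

section \<open>Elimination over polynomials: independence along a line\<close>

lemma row_indep_pivot:
  fixes A :: "'c \<Rightarrow> 'k \<Rightarrow> real"
  assumes "finite C" "e \<in> C" "k \<in> K" "A e k \<noteq> 0"
  shows "row_indep K C A \<longleftrightarrow> row_indep K (C - {e}) (\<lambda>f j. A e k * A f j - A f k * A e j)"
    (is "_ \<longleftrightarrow> row_indep K _ ?B")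
proof
  have split: "(\<Sum>c\<in>C. g c) = g e + (\<Sum>c\<in>C-{e}. g c)" for g :: "'c \<Rightarrow> real"
    using assms by (intro sum.remove) auto
  have sumB: "(\<Sum>f\<in>C-{e}. w f * ?B f j) =
      A e k * (\<Sum>f\<in>C-{e}. w f * A f j) - (\<Sum>f\<in>C-{e}. w f * A f k) * A e j" for w :: "'c \<Rightarrow> real" and j
    by (simp add: sum_distrib_left sum_distrib_right sum_subtractf[symmetric] algebra_simps)
  {
    assume ind: "row_indep K C A"
    show "row_indep K (C - {e}) ?B"
    proof (rule row_indepI)
      fix w c assume w: "\<And>j. j \<in> K \<Longrightarrow> (\<Sum>f\<in>C-{e}. w f *\<^sub>R ?B f j) = 0" and c: "c \<in> C - {e}"
      define s where "s = (\<Sum>f\<in>C-{e}. w f * A f k)"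
      define u where "u = (\<lambda>f. if f = e then - s else A e k * w f)"
      have "(\<Sum>f\<in>C. u f *\<^sub>R A f j) = 0" if "j \<in> K" for j
      proof -
        have "(\<Sum>f\<in>C. u f * A f j) = - s * A e j + (\<Sum>f\<in>C-{e}. A e k * (w f * A f j))"
          unfolding split by (auto simp: u_def intro!: sum.cong)
        then show ?thesis using w[OF that] sumB[of w j] by (simp add: s_def sum_distrib_left)
      qed
      then have "u c = 0" using row_indepD[OF ind, of u c] c by simp
      then show "w c = 0" using c assms by (simp add: u_def)
    qed
  }
  {
    assume ind: "row_indep K (C - {e}) ?B"
    show "row_indep K C A"
    proof (rule row_indepI)
      fix w c assume w: "\<And>j. j \<in> K \<Longrightarrow> (\<Sum>f\<in>C. w f *\<^sub>R A f j) = 0" and c: "c \<in> C"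
      have eq: "(\<Sum>f\<in>C-{e}. w f * A f j) = - w e * A e j" if "j \<in> K" for j
        using w[OF that] unfolding real_scaleR_def split by simp
      have "(\<Sum>f\<in>C-{e}. w f *\<^sub>R ?B f j) = 0" if "j \<in> K" for j
        using sumB[of w j] eq[OF that] eq[OF assms(3)] by simp
      then have rest: "w f = 0" if "f \<in> C - {e}" for f
        using row_indepD[OF ind, of w f] that by simp
      have "(\<Sum>f\<in>C-{e}. w f * A f k) = 0" by (intro sum.neutral) (use rest in auto)
      then have "w e = 0" using eq[OF assms(3)] assms(4) by simp
      then show "w c = 0" using rest c by auto
    qed
  }
qed

text \<open>Elimination takes the place of minors. Independence at \<open>t0\<close> supplies a
  pivot polynomial that is not zero, and away from its finitely many roots the question passes to a
  matrix with one row fewer.\<close>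

lemma row_indep_poly_finite_exceptions:
  fixes B :: "'c \<Rightarrow> 'k \<Rightarrow> real poly"
  assumes "finite C" "row_indep K C (\<lambda>c k. poly (B c k) t0)"
  shows "finite {t. \<not> row_indep K C (\<lambda>c k. poly (B c k) t)}"
  using assms
proof (induction C arbitrary: B rule: finite_induct)
  case empty
  then show ?case by (simp add: row_indep_def)
next
  case (insert e C)
  obtain k where k: "k \<in> K" "poly (B e k) t0 \<noteq> 0"
    using row_indep_row_nonzero[OF insert.prems, of e] by auto
  \<comment> \<open>Cross-multiplication instead of division keeps the entries polynomial.\<close>
  define B' where "B' = (\<lambda>f j. B e k * B f j - B f k * B e j)"
  have pivot: "row_indep K (insert e C) (\<lambda>c k. poly (B c k) t) \<longleftrightarrow> row_indep K C (\<lambda>c k. poly (B' c k) t)"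
    if "poly (B e k) t \<noteq> 0" for t
    using row_indep_pivot[of "insert e C" e k K "\<lambda>c k. poly (B c k) t"] insert.hyps k that
    by (simp add: B'_def)
  have "{t. \<not> row_indep K (insert e C) (\<lambda>c k. poly (B c k) t)} \<subseteq>
      {t. poly (B e k) t = 0} \<union> {t. \<not> row_indep K C (\<lambda>c k. poly (B' c k) t)}"
    using pivot by auto
  moreover have "finite {t. poly (B e k) t = 0}" using k by (intro poly_roots_finite) auto
  moreover have "finite {t. \<not> row_indep K C (\<lambda>c k. poly (B' c k) t)}"
    using insert.IH[of B'] insert.prems pivot[OF k(2)] by simp
  ultimately show ?case by (meson finite_UnI finite_subset)
qed

lemma row_indep_line_finite_exceptions:
  fixes A B :: "'c \<Rightarrow> 'k \<Rightarrow> 'a::euclidean_space"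
  assumes "finite C" "row_indep K C A"
  shows "finite {t. \<not> row_indep K C (\<lambda>c k. (1 - t) *\<^sub>R A c k + t *\<^sub>R B c k)}"
proof -
  define Q where "Q = (\<lambda>c (k, b). [: A c k \<bullet> b, B c k \<bullet> b - A c k \<bullet> b :])"
  have Q: "row_indep K C (\<lambda>c k. (1 - t) *\<^sub>R A c k + t *\<^sub>R B c k) \<longleftrightarrow>
      row_indep (K \<times> Basis) C (\<lambda>c k. poly (Q c k) t)" for t
    unfolding row_indep_coordinates[of K C "\<lambda>c k. (1 - t) *\<^sub>R A c k + t *\<^sub>R B c k"]
    by (intro row_indep_cong) (auto simp: Q_def algebra_simps)
  show ?thesis
    unfolding Q using Q[of 0] assms by (intro row_indep_poly_finite_exceptions[of C _ Q 0]) simp_all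
qed

section \<open>Generic properties\<close>

text \<open>A substitute for Zariski openness that only speaks of lines through a point with the
  property. It holds for the empty property too, so existence has to be carried along
  separately.\<close>

definition line_generic :: "(('v \<Rightarrow> 'a::real_vector) \<Rightarrow> bool) \<Rightarrow> bool" where
  "line_generic Q \<longleftrightarrow> (\<forall>x y. Q x \<longrightarrow> finite {t. \<not> Q (\<lambda>v. (1 - t) *\<^sub>R x v + t *\<^sub>R y v)})"

lemma line_genericD:
  assumes "line_generic Q" "Q x"
  shows "finite {t. \<not> Q (\<lambda>v. (1 - t) *\<^sub>R x v + t *\<^sub>R y v)}"
  using assms unfolding line_generic_def by blast

text \<open>On the line that joins a witness of \<open>Q\<close> to a witness of \<open>R\<close>,
  each property fails only finitely often, so some point has both.\<close>

lemma line_generic_conj: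
  assumes Q: "line_generic Q" "Q x" and R: "line_generic R" "R y"
  shows "line_generic (\<lambda>z. Q z \<and> R z)" "\<exists>z. Q z \<and> R z"
proof -
  show "line_generic (\<lambda>z. Q z \<and> R z)"
    unfolding line_generic_def
  proof (intro allI impI)
    fix x y assume "Q x \<and> R x"
    then have "finite ({t. \<not> Q (\<lambda>v. (1 - t) *\<^sub>R x v + t *\<^sub>R y v)} \<union>
        {t. \<not> R (\<lambda>v. (1 - t) *\<^sub>R x v + t *\<^sub>R y v)})"
      using Q(1) R(1) unfolding line_generic_def by blast
    then show "finite {t. \<not> (Q (\<lambda>v. (1 - t) *\<^sub>R x v + t *\<^sub>R y v) \<and> R (\<lambda>v. (1 - t) *\<^sub>R x v + t *\<^sub>R y v))}"
      by (rule rev_finite_subset) auto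
  qed
  have finQ: "finite {t. \<not> Q (\<lambda>v. (1 - t) *\<^sub>R x v + t *\<^sub>R y v)}"
    using Q unfolding line_generic_def by blast
  have "finite {t. \<not> R (\<lambda>v. (1 - t) *\<^sub>R y v + t *\<^sub>R x v)}"
    using R unfolding line_generic_def by blast
  moreover have "{t. \<not> R (\<lambda>v. (1 - t) *\<^sub>R x v + t *\<^sub>R y v)} \<subseteq>
      (\<lambda>t. 1 - t) ` {t. \<not> R (\<lambda>v. (1 - t) *\<^sub>R y v + t *\<^sub>R x v)}"
  proof
    fix t assume "t \<in> {t. \<not> R (\<lambda>v. (1 - t) *\<^sub>R x v + t *\<^sub>R y v)}"
    then have "1 - t \<in> {t. \<not> R (\<lambda>v. (1 - t) *\<^sub>R y v + t *\<^sub>R x v)}"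
      by (simp add: add.commute)
    then show "t \<in> (\<lambda>t. 1 - t) ` {t. \<not> R (\<lambda>v. (1 - t) *\<^sub>R y v + t *\<^sub>R x v)}"
      by (rule rev_image_eqI) simp
  qed
  ultimately have "finite {t. \<not> R (\<lambda>v. (1 - t) *\<^sub>R x v + t *\<^sub>R y v)}"
    using finite_surj by blast
  from ex_new_if_finite[OF infinite_UNIV_char_0 finite_UnI[OF finQ this]]
  show "\<exists>z. Q z \<and> R z" by blast
qed

lemma line_generic_finite_Ball:
  assumes "finite S" "\<And>s. s \<in> S \<Longrightarrow> line_generic (Q s)" "\<And>s. s \<in> S \<Longrightarrow> \<exists>x. Q s x"
  shows "line_generic (\<lambda>x. \<forall>s\<in>S. Q s x)" "\<exists>x. \<forall>s\<in>S. Q s x"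
proof -
  have "line_generic (\<lambda>x. \<forall>s\<in>S. Q s x) \<and> (\<exists>x. \<forall>s\<in>S. Q s x)"
    using assms
  proof (induction S rule: finite_induct)
    case empty
    then show ?case by (simp add: line_generic_def)
  next
    case (insert s S)
    obtain x where x: "\<forall>s\<in>S. Q s x" using insert.IH insert.prems by auto
    obtain y where y: "Q s y" using insert.prems by auto
    have "line_generic (Q s)" "line_generic (\<lambda>x. \<forall>s\<in>S. Q s x)"
      using insert.IH insert.prems by auto
    from line_generic_conj[OF this(1) y this(2) x] show ?case by simp
  qed
  then show "line_generic (\<lambda>x. \<forall>s\<in>S. Q s x)" "\<exists>x. \<forall>s\<in>S. Q s x" by auto
qed

lemma line_generic_row_indep:
  fixes R :: "('v \<Rightarrow> 'a::real_vector) \<Rightarrow> 'c \<Rightarrow> 'k \<Rightarrow> 'b::euclidean_space"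
  assumes "finite C"
    and "\<And>x y t c k. R (\<lambda>v. (1 - t) *\<^sub>R x v + t *\<^sub>R y v) c k = (1 - t) *\<^sub>R R x c k + t *\<^sub>R R y c k"
  shows "line_generic (\<lambda>x. row_indep K C (R x))"
  unfolding line_generic_def
proof (intro allI impI)
  fix x y assume "row_indep K C (R x)"
  moreover have "R (\<lambda>v. (1 - t) *\<^sub>R x v + t *\<^sub>R y v) = (\<lambda>c k. (1 - t) *\<^sub>R R x c k + t *\<^sub>R R y c k)" for t
    using assms(2) by blast
  ultimately show "finite {t. \<not> row_indep K C (R (\<lambda>v. (1 - t) *\<^sub>R x v + t *\<^sub>R y v))}"
    using row_indep_line_finite_exceptions[OF assms(1), of K "R x" "R y"] by simp
qed

section \<open>Frame matrices of multigraphs\<close>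

text \<open>The row of an oriented incidence matrix, weighted by a vector: a frame matrix for
  prescribed directions \<open>d\<close>, and the rigidity matrix when \<open>d e\<close> is the
  difference of the end positions. A loop has the zero row.\<close>

definition edge_row :: "('e \<Rightarrow> 'w) \<Rightarrow> ('e \<Rightarrow> 'w) \<Rightarrow> ('e \<Rightarrow> 'a::real_vector) \<Rightarrow> 'e \<Rightarrow> 'w \<Rightarrow> 'a" where
  "edge_row s t d e i = (of_bool (i = s e) - of_bool (i = t e)) *\<^sub>R d e"

text \<open>Ends of \<open>e\<close> outside \<open>K\<close> are allowed: their columns are
  deleted, which amounts to fixing \<open>z\<close> to zero there. Pins are treated in this
  way.\<close>

lemma sum_edge_row_inner:
  assumes "finite K" "\<forall>i. i \<notin> K \<longrightarrow> z i = 0"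
  shows "(\<Sum>i\<in>K. edge_row s t d e i \<bullet> z i) = d e \<bullet> (z (s e) - z (t e))"
proof -
  have *: "(\<Sum>i\<in>K. of_bool (i = a) * (d e \<bullet> z i)) = d e \<bullet> z a" for a
    using assms by (cases "a \<in> K") (simp_all add: of_bool_def if_distrib[of "\<lambda>x. x * _"] cong: if_cong)
  show ?thesis
    by (simp add: edge_row_def inner_diff_right left_diff_distrib sum_subtractf *)
qed

lemma line_generic_edge_row:
  fixes K :: "'w set"
  assumes "finite C"
  shows "line_generic (\<lambda>d::'e \<Rightarrow> 'a::euclidean_space. row_indep K C (edge_row s t d))"
  using assms by (rule line_generic_row_indep) (simp add: edge_row_def algebra_simps)

text \<open>The columns of all vertices add up to zero, so the column of \<open>v\<close> is
  determined by the others and deleting it loses no rank.\<close>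

lemma row_indep_edge_row_remove_vertex:
  assumes "finite W" "s ` C \<union> t ` C \<subseteq> W" "row_indep W C (edge_row s t d)"
  shows "row_indep (W - {v}) C (edge_row s t d)"
proof (rule row_indepI)
  fix w c assume w: "\<And>k. k \<in> W - {v} \<Longrightarrow> (\<Sum>c\<in>C. w c *\<^sub>R edge_row s t d c k) = 0" and c: "c \<in> C"
  have "(\<Sum>k\<in>W. edge_row s t d c k) = 0" if "c \<in> C" for c
    using that assms(1,2) by (simp add: edge_row_def scaleR_sum_left[symmetric] sum_subtractf of_bool_def image_subset_iff)
  then have total: "(\<Sum>k\<in>W. \<Sum>c\<in>C. w c *\<^sub>R edge_row s t d c k) = 0"
    by (subst sum.swap) (simp add: scaleR_sum_right[symmetric])
  have "(\<Sum>c\<in>C. w c *\<^sub>R edge_row s t d c k) = 0" if "k \<in> W" for k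
  proof (cases "k = v")
    case True
    then show ?thesis using total that w assms(1) by (simp add: sum.remove[of W v])
  qed (use w that in auto)
  then show "w c = 0" using row_indepD[OF assms(3), of w c] c by blast
qed

lemma sparse_frame_row_indep:
  fixes C :: "'e set" and s t :: "'e \<Rightarrow> 'w"
  assumes "finite C" "finite W" "s ` C \<union> t ` C \<subseteq> W"
    and "\<And>F. F \<subseteq> C \<Longrightarrow> F \<noteq> {} \<Longrightarrow> card F + DIM('a) \<le> DIM('a) * card (s ` F \<union> t ` F)"
  shows "\<exists>d::'e \<Rightarrow> 'a::euclidean_space. row_indep W C (edge_row s t d)"
  using assms(1,3,4)
proof (induction C rule: finite_psubset_induct)
  case (psubset C)
  show ?case
  proof (rule ccontr)
    assume no: "\<nexists>d::'e \<Rightarrow> 'a. row_indep W C (edge_row s t d)"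
    have sub: "\<exists>d::'e \<Rightarrow> 'a. row_indep W (C - {e}) (edge_row s t d)" if "e \<in> C" for e
      using that psubset.prems by (intro psubset.IH) auto
    \<comment> \<open>Each proper deletion is independent for some directions, hence all of them are
      for one common generic \<open>d\<close>, while \<open>C\<close> itself is dependent for all
      directions.\<close>
    obtain d :: "'e \<Rightarrow> 'a" where d: "\<forall>e\<in>C. row_indep W (C - {e}) (edge_row s t d)"
      using line_generic_finite_Ball(2)[of C "\<lambda>e d. row_indep W (C - {e}) (edge_row s t d)",
          OF psubset.hyps line_generic_edge_row sub] psubset.hyps by blast
    \<comment> \<open>Changing \<open>d\<close> at \<open>e\<close> alone leaves the rows of
      \<open>C - {e}\<close> independent, so a dependency of \<open>C\<close> must involve
      \<open>e\<close>.\<close>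
    have dependency: "\<exists>w. w e \<noteq> 0 \<and> (\<forall>k\<in>W. (\<Sum>c\<in>C. w c *\<^sub>R edge_row s t d' c k) = 0)"
      if e: "e \<in> C" and d': "\<And>c. c \<noteq> e \<Longrightarrow> d' c = d c" for e d'
    proof -
      obtain w c where w: "\<forall>k\<in>W. (\<Sum>c\<in>C. w c *\<^sub>R edge_row s t d' c k) = 0" "c \<in> C" "w c \<noteq> 0"
        using no unfolding row_indep_def by blast
      have "row_indep W (C - {e}) (edge_row s t d')"
        using d e d' by (subst row_indep_cong[where B = "edge_row s t d"]) (auto simp: edge_row_def)
      then have "w e \<noteq> 0"
        using row_indep_remove_dependency_zero[of C W e "edge_row s t d'" w c] psubset.hyps w by blast
      with w show ?thesis by blast
    qed
    have pairing: "w e * (d' e \<bullet> (x (s e) - x (t e))) = 0"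
      if "e \<in> C" "\<forall>k\<in>W. (\<Sum>c\<in>C. w c *\<^sub>R edge_row s t d' c k) = 0" "\<forall>v. v \<notin> W \<longrightarrow> x v = 0"
        "\<forall>f\<in>C-{e}. d' f \<bullet> (x (s f) - x (t f)) = 0" for w d' e and x :: "'w \<Rightarrow> 'a"
    proof -
      have "0 = (\<Sum>c\<in>C. w c * (d' c \<bullet> (x (s c) - x (t c))))"
        using row_dependency_inner[of W w "edge_row s t d'" C x] that(2,3)
        by (simp add: sum_edge_row_inner[OF assms(2)])
      also have "\<dots> = w e * (d' e \<bullet> (x (s e) - x (t e)))"
        using psubset.hyps that by (subst sum.remove[of C e]) auto
      finally show ?thesis by simp
    qed
    \<comment> \<open>Turning the direction of \<open>e\<close> cannot increase the rank, so the kernel does not separate its ends.\<close>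
    have const: "x (s e) = x (t e)"
      if e: "e \<in> C" and x: "\<forall>v. v \<notin> W \<longrightarrow> x v = 0" "\<forall>f\<in>C. d f \<bullet> (x (s f) - x (t f)) = 0" for x e
    proof -
      \<comment> \<open>With this direction at \<open>e\<close> the pairing becomes the squared
        length of \<open>x (s e) - x (t e)\<close>.\<close>
      define d' where "d' = d(e := x (s e) - x (t e))"
      obtain w where "w e \<noteq> 0" "\<forall>k\<in>W. (\<Sum>c\<in>C. w c *\<^sub>R edge_row s t d' c k) = 0"
        using dependency[OF e, of d'] by (auto simp: d'_def)
      then show ?thesis using pairing[OF e, of w d' x] x by (simp add: d'_def)
    qed
    have "C \<noteq> {}" using no by (auto simp: row_indep_def)
    then obtain e0 where e0: "e0 \<in> C" by blast
    \<comment> \<open>The connected component of \<open>s e0\<close>.\<close>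
    define U where "U = {v\<in>W. \<forall>z::'w \<Rightarrow> 'a. (\<forall>e\<in>C. z (s e) = z (t e)) \<longrightarrow> z v = z (s e0)}"
    define F where "F = {e\<in>C. s e \<in> U}"
    have W: "s e \<in> W" "t e \<in> W" if "e \<in> C" for e using psubset.prems(1) that by auto
    \<comment> \<open>Describing the component by functions that agree at the two ends of every edge
      avoids paths: closure under edges is immediate, and so is the constancy of \<open>x\<close>
      used at the end.\<close>
    have ends: "s e \<in> U \<longleftrightarrow> t e \<in> U" if "e \<in> C" for e
      using that W unfolding U_def by simp
    have "finite U" using assms(2) by (simp add: U_def)
    have s0: "s e0 \<in> U" using e0 W by (simp add: U_def)
    then have "e0 \<in> F" using e0 by (simp add: F_def)
    have finF: "finite F" using psubset.hyps by (simp add: F_def)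
    have "card F + DIM('a) \<le> DIM('a) * card (s ` F \<union> t ` F)"
      using \<open>e0 \<in> F\<close> by (intro psubset.prems(2)) (auto simp: F_def)
    also have "\<dots> \<le> DIM('a) * card U"
      using \<open>finite U\<close> ends by (intro mult_le_mono2 card_mono) (auto simp: F_def)
    \<comment> \<open>Fixing \<open>s e0\<close> at zero uses up the slack in the count; dropping
      the equation of \<open>e0\<close> as well leaves fewer equations than unknowns.\<close>
    finally have "card F \<le> DIM('a) * card (U - {s e0})"
      using s0 \<open>finite U\<close> by (simp add: card_Diff_singleton right_diff_distrib')
    moreover have "card (F - {e0}) < card F" using \<open>e0 \<in> F\<close> finF by (rule card_Diff1_less[rotated])
    ultimately obtain x :: "'w \<Rightarrow> 'a" where x: "\<exists>k\<in>U - {s e0}. x k \<noteq> 0"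
      "\<forall>k. k \<notin> U - {s e0} \<longrightarrow> x k = 0"
      "\<forall>c\<in>F-{e0}. (\<Sum>k\<in>U - {s e0}. edge_row s t d c k \<bullet> x k) = 0"
      using nontrivial_kernel[of "U - {s e0}" "F - {e0}" "edge_row s t d"] \<open>finite U\<close> finF by auto
    have xW: "\<forall>v. v \<notin> W \<longrightarrow> x v = 0" using x(2) by (auto simp: U_def)
    have "\<forall>f\<in>C-{e0}. d f \<bullet> (x (s f) - x (t f)) = 0"
    proof
      fix f assume f: "f \<in> C - {e0}"
      show "d f \<bullet> (x (s f) - x (t f)) = 0"
      proof (cases "s f \<in> U")
        case True
        then have "f \<in> F - {e0}" using f by (simp add: F_def)
        with x(3) have "(\<Sum>k\<in>U - {s e0}. edge_row s t d f k \<bullet> x k) = 0" by blast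
        then show ?thesis using sum_edge_row_inner[of "U - {s e0}" x s t d f] \<open>finite U\<close> x(2) by simp
      next
        case False
        then show ?thesis using ends[of f] f x(2) by simp
      qed
    qed
    moreover obtain w where "w e0 \<noteq> 0" "\<forall>k\<in>W. (\<Sum>c\<in>C. w c *\<^sub>R edge_row s t d c k) = 0"
      using dependency[OF e0, of d] by auto
    \<comment> \<open>The omitted equation of \<open>e0\<close> comes back through the pairing,
      since \<open>w e0\<close> is non-zero.\<close>
    ultimately have "\<forall>f\<in>C. d f \<bullet> (x (s f) - x (t f)) = 0"
      using pairing[OF e0, of w d x] xW by auto
    then have "\<forall>e\<in>C. x (s e) = x (t e)" using const xW by blast
    then have "x v = x (s e0)" if "v \<in> U" for v using that unfolding U_def by blast
    moreover have "x (s e0) = 0" using x(2) by simp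
    ultimately have "x v = 0" if "v \<in> U" for v using that by simp
    with x(1) show False by blast
  qed
qed

section \<open>Rigidity circuits in the plane\<close>

definition perp :: "real^2 \<Rightarrow> real^2" where
  "perp v = vector [- v $ 2, v $ 1]"

lemma linear_perp: "linear perp"
  by (rule linearI) (simp_all add: perp_def vec_eq_iff forall_2)

lemma inner_perp_self [simp]: "v \<bullet> perp v = 0"
  by (simp add: perp_def inner_vec_def sum_2)

lemma perp_eq_0_iff [simp]: "perp v = 0 \<longleftrightarrow> v = 0"
  by (auto simp add: perp_def vec_eq_iff forall_2)

lemma orthogonal_imp_parallel_perp:
  assumes "d \<bullet> v = 0" "v \<noteq> 0"
  shows "\<exists>c. d = c *\<^sub>R perp v"
proof -
  have "d $ 1 * v $ 1 + d $ 2 * v $ 2 = 0" using assms(1) by (simp add: inner_vec_def sum_2)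
  moreover have "v $ 1 \<noteq> 0 \<or> v $ 2 \<noteq> 0" using assms(2) by (auto simp: vec_eq_iff forall_2)
  ultimately have "d = (d $ 2 / v $ 1) *\<^sub>R perp v \<or> d = (- d $ 1 / v $ 2) *\<^sub>R perp v"
    by (auto simp: perp_def vec_eq_iff forall_2 field_simps)
  then show ?thesis by blast
qed

text \<open>A kernel vector of the frame matrix is a drawing whose edges are orthogonal to the
  directions \<open>d\<close>. After a quarter turn they are parallel to \<open>d\<close>, so if no
  edge collapses, the rigidity rows are non-zero multiples of the frame rows and inherit their
  independence.\<close>

lemma circuit_remove_edge_row_indep:
  fixes s t :: "'e \<Rightarrow> 'w"
  assumes "finite E" "card E + 2 = 2 * card W" "W = s ` E \<union> t ` E"
    and sparse: "\<And>F. F \<subset> E \<Longrightarrow> F \<noteq> {} \<Longrightarrow> card F + 3 \<le> 2 * card (s ` F \<union> t ` F)"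
    and e0: "e0 \<in> E" and w0: "w0 \<in> W"
  shows "\<exists>p::'w \<Rightarrow> real^2. row_indep (W - {w0}) (E - {e0}) (edge_row s t (\<lambda>e. p (s e) - p (t e)))"
proof -
  \<comment> \<open>The slot of \<open>e0\<close> is used for a second copy of another edge \<open>f\<close>: the doubled graph still has
    independent rows for generic directions, hence the ends of \<open>f\<close> stay distinct in every
    drawing of \<open>E - {e0}\<close> with the prescribed directions.\<close>
  let ?s = "\<lambda>f. s(e0 := s f)" and ?t = "\<lambda>f. t(e0 := t f)"
  have finW: "finite W" using assms by simp
  have endsW: "?s f ` E \<union> ?t f ` E \<subseteq> W" if "f \<in> E" for f
    using that assms(3) by auto
  have ex: "\<exists>d::'e \<Rightarrow> real^2. row_indep W E (edge_row (?s f) (?t f) d)" if f: "f \<in> E - {e0}" for f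
  proof (rule sparse_frame_row_indep[OF assms(1) finW endsW])
    show "f \<in> E" using f by simp
    fix F assume F: "F \<subseteq> E" "F \<noteq> {}"
    show "card F + DIM(real^2) \<le> DIM(real^2) * card (?s f ` F \<union> ?t f ` F)"
    proof (cases "e0 \<in> F")
      case False
      then have "?s f ` F = s ` F" "?t f ` F = t ` F" by (auto intro!: image_cong)
      moreover have "F \<subset> E" using F(1) False e0 by blast
      ultimately show ?thesis using sparse[of F] F(2) by (simp del: fun_upd_apply)
    next
      case True
      \<comment> \<open>Replacing \<open>e0\<close> by \<open>f\<close> loses at most one edge and
        gives a proper subset of the circuit, so its bound with 3 becomes the bound with 2 required
        for \<open>F\<close>.\<close>
      define G where "G = insert f (F - {e0})"
      have "finite F" using F assms(1) finite_subset by blast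
      then have "card F \<le> card G + 1" using True
        by (auto simp: G_def card_insert_if card_Diff_singleton)
      moreover have "card G + 3 \<le> 2 * card (s ` G \<union> t ` G)"
        using F f e0 by (intro sparse) (auto simp: G_def)
      moreover have "s ` G = ?s f ` F" "t ` G = ?t f ` F" using True by (auto simp: G_def)
      ultimately show ?thesis by simp
    qed
  qed
  obtain d :: "'e \<Rightarrow> real^2" where d: "\<forall>f\<in>E-{e0}. row_indep W E (edge_row (?s f) (?t f) d)"
    using line_generic_finite_Ball(2)[of "E - {e0}" "\<lambda>f d. row_indep W E (edge_row (?s f) (?t f) d)",
        OF _ line_generic_edge_row ex] assms(1) by blast
  define K where "K = W - {w0}"
  have K: "finite K" "card E = 2 * card K"
    using finW w0 assms(2) by (auto simp: K_def card_Diff_singleton right_diff_distrib')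
  have dK: "row_indep K E (edge_row (?s f) (?t f) d)" if "f \<in> E - {e0}" for f
    unfolding K_def using d that by (intro row_indep_edge_row_remove_vertex[OF finW endsW]) auto
  have dS: "row_indep K (E - {e0}) (edge_row s t d)" if "f \<in> E - {e0}" for f
  proof -
    have "row_indep K (E - {e0}) (edge_row (?s f) (?t f) d)"
      using row_indep_subset[OF dK[OF that]] assms(1) by blast
    then show ?thesis by (subst row_indep_cong[where B = "edge_row (?s f) (?t f) d"]) (auto simp: edge_row_def)
  qed
  \<comment> \<open>With \<open>w0\<close> held at the origin the doubled system is square; without
    the slot of \<open>e0\<close> a non-zero drawing must exist.\<close>
  have "card (E - {e0}) < DIM(real^2) * card K"
    using card_Diff1_less[OF assms(1) e0] K by simp
  then obtain x :: "'w \<Rightarrow> real^2" where x: "\<exists>k\<in>K. x k \<noteq> 0" "\<forall>k. k \<notin> K \<longrightarrow> x k = 0"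
      "\<forall>c\<in>E-{e0}. (\<Sum>k\<in>K. edge_row s t d c k \<bullet> x k) = 0"
    using nontrivial_kernel[of K "E - {e0}" "edge_row s t d"] K assms(1) by auto
  have xd: "d c \<bullet> (x (s c) - x (t c)) = 0" if "c \<in> E - {e0}" for c
    using x(3) that sum_edge_row_inner[OF K(1) x(2), of s t d c] by auto
  have neq: "x (s f) \<noteq> x (t f)" if f: "f \<in> E - {e0}" for f
  proof
    \<comment> \<open>A collapsed \<open>f\<close> would also satisfy the equation in the slot of
      \<open>e0\<close>, whatever its direction, and put \<open>x\<close> into the kernel of an
      independent square matrix.\<close>
    assume "x (s f) = x (t f)"
    then have "\<forall>c\<in>E. (\<Sum>k\<in>K. edge_row (?s f) (?t f) d c k \<bullet> x k) = 0"
      unfolding sum_edge_row_inner[OF K(1) x(2)] using xd by auto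
    with row_indep_square_kernel[OF K(1) assms(1) _ dK[OF f]] K(2) have "\<forall>k\<in>K. x k = 0" by auto
    with x(1) show False by blast
  qed
  have "\<exists>a. a \<noteq> 0 \<and> d f = a *\<^sub>R perp (x (s f) - x (t f))" if f: "f \<in> E - {e0}" for f
  proof -
    obtain a where a: "d f = a *\<^sub>R perp (x (s f) - x (t f))"
      using orthogonal_imp_parallel_perp[OF xd[OF f]] neq[OF f] by auto
    moreover have "d f \<noteq> 0" using row_indep_row_nonzero[OF dS[OF f] f] by (auto simp: edge_row_def)
    ultimately show ?thesis by auto
  qed
  then obtain a where a: "\<And>f. f \<in> E - {e0} \<Longrightarrow> a f \<noteq> 0"
      "\<And>f. f \<in> E - {e0} \<Longrightarrow> d f = a f *\<^sub>R perp (x (s f) - x (t f))" by metis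
  define p where "p = perp \<circ> x"
  have "row_indep K (E - {e0}) (edge_row s t (\<lambda>e. p (s e) - p (t e)))"
  \<comment> \<open>The fact \<open>dS\<close> needs some edge \<open>f\<close> to double.\<close>
  proof (cases "E - {e0} = {}")
    case True
    then show ?thesis unfolding row_indep_def by blast
  next
    case False
    then obtain f where f: "f \<in> E - {e0}" by blast
    have "row_indep K (E - {e0}) (\<lambda>c k. a c *\<^sub>R edge_row s t (\<lambda>e. p (s e) - p (t e)) c k)"
      using dS[OF f] a(2)
      by (subst row_indep_cong[where B = "edge_row s t d"])
        (auto simp: edge_row_def p_def linear_diff[OF linear_perp])
    then show ?thesis using a(1) by (rule row_indep_rescale)
  qed
  then show ?thesis unfolding K_def by blast
qed

section \<open>Pinned frameworks\<close>

abbreviation rigidity_row :: "('e \<Rightarrow> 'v) \<Rightarrow> ('e \<Rightarrow> 'v) \<Rightarrow> ('v \<Rightarrow> 'a::real_vector) \<Rightarrow> 'e \<Rightarrow> 'v \<Rightarrow> 'a" where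
  "rigidity_row s t p \<equiv> edge_row s t (\<lambda>e. p (s e) - p (t e))"

lemma line_generic_rigidity_row:
  fixes K :: "'v set"
  assumes "finite C"
  shows "line_generic (\<lambda>p::'v \<Rightarrow> 'a::euclidean_space. row_indep K C (rigidity_row s t p))"
  using assms by (rule line_generic_row_indep) (simp add: edge_row_def algebra_simps)

text \<open>Distinctness of two points is the independence of a single row with a single
  entry.\<close>

lemma line_generic_neq:
  "line_generic (\<lambda>p::'v \<Rightarrow> 'a::euclidean_space. p u \<noteq> p v)"
proof -
  have "line_generic (\<lambda>p::'v \<Rightarrow> 'a. row_indep {()} {()} (\<lambda>_ _. p u - p v))"
    by (rule line_generic_row_indep) (simp_all add: algebra_simps)
  moreover have "row_indep {()} {()} (\<lambda>_ _. p u - p v) \<longleftrightarrow> p u \<noteq> p v" for p :: "'v \<Rightarrow> 'a"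
    by (auto simp: row_indep_def dest: spec[of _ "\<lambda>_. 1"])
  ultimately show ?thesis by simp
qed

section \<open>Motions and self-stresses in terms of the rigidity matrix\<close>

lemma first_order_motion_iff:
  assumes "\<And>e. e \<in> E \<Longrightarrow> e = {s e, t e}"
  shows "first_order_motion I P E p q \<longleftrightarrow> (\<forall>v. v \<notin> I \<longrightarrow> q v = 0) \<and>
     (\<forall>e\<in>E. (p (s e) - p (t e)) \<bullet> (q (s e) - q (t e)) = 0)"
proof -
  have "(p i - p j) \<bullet> (q i - q j) = (p (s e) - p (t e)) \<bullet> (q (s e) - q (t e))"
    if "e \<in> E" "e = {i, j}" for e i j
  proof -
    have "{i, j} = {s e, t e}" using assms that by blast
    then show ?thesis by (auto simp: doubleton_eq_iff inner_diff_left inner_diff_right)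
  qed
  moreover have "\<exists>i j. e = {i, j}" if "e \<in> E" for e using assms[OF that] by blast
  ultimately show ?thesis unfolding first_order_motion_def by metis
qed

text \<open>The map from \<open>j\<close> to \<open>{i, j}\<close> turns the sum over neighbours
  into one over edges. The orientation does not matter, because at \<open>i\<close> both the sign
  and the difference of positions flip with it.\<close>

lemma self_stress_iff:
  assumes "\<And>e. e \<in> E \<Longrightarrow> e = {s e, t e} \<and> s e \<noteq> t e" "finite E"
  shows "self_stress I P E p w \<longleftrightarrow> (\<forall>e. e \<notin> E \<longrightarrow> w e = 0) \<and>
     (\<forall>i\<in>I. (\<Sum>e\<in>E. w e *\<^sub>R rigidity_row s t p e i) = 0)"
proof -
  have "(\<Sum>j\<in>{j. {i, j} \<in> E}. w {i, j} *\<^sub>R (p i - p j)) = (\<Sum>e\<in>E. w e *\<^sub>R rigidity_row s t p e i)" for i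
  proof -
    have row: "rigidity_row s t p {i, j} i = p i - p j" if "{i, j} \<in> E" for j
    proof -
      have "{i, j} = {s {i, j}, t {i, j}}" "s {i, j} \<noteq> t {i, j}" using assms(1)[OF that] by auto
      then consider "s {i, j} = i" "t {i, j} = j" "i \<noteq> j" | "s {i, j} = j" "t {i, j} = i" "i \<noteq> j"
        by (metis doubleton_eq_iff)
      then show ?thesis by cases (simp_all add: edge_row_def)
    qed
    have inj: "inj_on (\<lambda>j. {i, j}) {j. {i, j} \<in> E}" by (auto simp: inj_on_def doubleton_eq_iff)
    have "(\<Sum>j\<in>{j. {i, j} \<in> E}. w {i, j} *\<^sub>R (p i - p j)) =
        (\<Sum>e\<in>(\<lambda>j. {i, j}) ` {j. {i, j} \<in> E}. w e *\<^sub>R rigidity_row s t p e i)"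
      by (subst sum.reindex[OF inj]) (auto intro!: sum.cong simp: row)
    also have "\<dots> = (\<Sum>e\<in>E. w e *\<^sub>R rigidity_row s t p e i)"
    proof (rule sum.mono_neutral_left[OF assms(2)])
      show "\<forall>e\<in>E - (\<lambda>j. {i, j}) ` {j. {i, j} \<in> E}. w e *\<^sub>R rigidity_row s t p e i = 0"
      proof
        fix e assume e: "e \<in> E - (\<lambda>j. {i, j}) ` {j. {i, j} \<in> E}"
        have e_eq: "e = {s e, t e}" using assms(1) e by blast
        have "i \<noteq> s e"
        proof
          assume "i = s e"
          then have "e = {i, t e}" using e_eq by simp
          then show False using e by (metis (mono_tags, lifting) DiffE image_eqI mem_Collect_eq)
        qed
        moreover have "i \<noteq> t e"
        proof
          assume "i = t e"
          then have "e = {i, s e}" using e_eq by (simp add: insert_commute)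
          then show False using e by (metis (mono_tags, lifting) DiffE image_eqI mem_Collect_eq)
        qed
        ultimately show "w e *\<^sub>R rigidity_row s t p e i = 0" by (simp add: edge_row_def)
      qed
    qed auto
    finally show ?thesis .
  qed
  then show ?thesis unfolding self_stress_def by simp
qed

text \<open>The merged graph is a circuit, with \<open>None\<close> as the merged pin. Deleting the
  column of \<open>None\<close> and translating its position to the origin gives the rows of the
  pinned framework with all pins at the origin.\<close>

lemma assur_graph_coincident_pins:
  fixes I P :: "'v set" and E :: "'v set set"
  assumes assur: "assur_graph I P E"
    and ends: "\<And>e. e \<in> E \<Longrightarrow> e = {s e, t e}"
  obtains x :: "'v \<Rightarrow> real^2" where "\<forall>v. v \<notin> I \<longrightarrow> x v = 0" "\<forall>i\<in>I. x i \<noteq> 0"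
    "\<forall>e\<in>E. row_indep I (E - {e}) (rigidity_row s t x)"
proof -
  have pg: "finite I" "finite P" "I \<inter> P = {}" "finite E" "\<And>e. e \<in> E \<Longrightarrow> e \<subseteq> I \<union> P" and cardE: "card E = 2 * card I"
    using assur by (auto simp: assur_graph_def pinned_isostatic_def pinned_graph_def)
  have endsIP: "s e \<in> I \<union> P" "t e \<in> I \<union> P" if "e \<in> E" for e
    using pg(5)[OF that] ends[OF that] by blast+
  define h where "h = identify_pins P"
  have circ: "rigidity_circuit E (\<lambda>e. h ` e)" using assur by (simp add: assur_graph_def h_def)
  have hI: "h i = Some i" if "i \<in> I" for i using that pg(3) by (auto simp: h_def identify_pins_def)
  have hP: "h i = None" if "i \<in> P" for i using that by (auto simp: h_def identify_pins_def)
  define S where "S = h \<circ> s"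
  define T where "T = h \<circ> t"
  have mgv: "mg_vertices (\<lambda>e. h ` e) F = S ` F \<union> T ` F" if "F \<subseteq> E" for F
  proof -
    have "h ` e = {S e, T e}" if "e \<in> F" for e
      using ends[of e] that \<open>F \<subseteq> E\<close> by (metis S_def T_def comp_apply image_empty image_insert subsetD)
    then show ?thesis by (auto simp: mg_vertices_def)
  qed
  define W where "W = S ` E \<union> T ` E"
  have cardW: "card E + 2 = 2 * card W"
    using circ mgv[of E] by (simp add: rigidity_circuit_def W_def)
  have sparse: "card F + 3 \<le> 2 * card (S ` F \<union> T ` F)" if "F \<subset> E" "F \<noteq> {}" for F
  proof -
    have "int (card F) \<le> 2 * int (card (mg_vertices (\<lambda>e. h ` e) F)) - 3"
      using circ that unfolding rigidity_circuit_def by blast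
    then show ?thesis using mgv[of F] that by auto
  qed
  have "W \<subseteq> insert None (Some ` I)"
    using endsIP hI hP by (fastforce simp: W_def S_def T_def)
  \<comment> \<open>Comparing \<open>2 * card W - 2\<close> with \<open>2 * card I\<close> shows
    that the edges reach every inner vertex and the merged pin.\<close>
  moreover have "card W = card (insert None (Some ` I))"
    using cardW cardE pg(1) by (simp add: card_image image_iff)
  ultimately have W: "W = insert None (Some ` I)" using pg(1) by (intro card_subset_eq) auto
  then have WI: "W - {None} = Some ` I" by auto
  have ex: "\<exists>p::'v option \<Rightarrow> real^2. row_indep (Some ` I) (E - {e}) (rigidity_row S T p)" if "e \<in> E" for e
    using circuit_remove_edge_row_indep[OF pg(4) cardW W_def sparse that, of None] W WI by simp
  let ?Q = "\<lambda>p::'v option \<Rightarrow> real^2. \<forall>e\<in>E. row_indep (Some ` I) (E - {e}) (rigidity_row S T p)"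
  \<comment> \<open>After the translation this says that no inner vertex lies at the origin.\<close>
  let ?R = "\<lambda>p::'v option \<Rightarrow> real^2. \<forall>i\<in>I. p (Some i) \<noteq> p None"
  have Q: "line_generic ?Q" "\<exists>p. ?Q p"
    by (rule line_generic_finite_Ball[OF pg(4) line_generic_rigidity_row ex]; use pg(4) in simp)+
  have "\<exists>p::'v option \<Rightarrow> real^2. p (Some i) \<noteq> p None" for i
    by (rule exI[of _ "case_option 0 (\<lambda>_. axis 1 1)"]) (simp add: axis_eq_0_iff)
  then have R: "line_generic ?R" "\<exists>p. ?R p"
    using line_generic_finite_Ball[of I "\<lambda>i (p::'v option \<Rightarrow> real^2). p (Some i) \<noteq> p None", OF pg(1) line_generic_neq]
    by blast+
  obtain p where p: "?Q p" "?R p" using line_generic_conj(2)[OF Q(1) _ R(1)] Q(2) R(2) by blast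
  define x where "x = (\<lambda>v. if v \<in> I then p (Some v) - p None else 0)"
  have xh: "x v = p (h v) - p None" if "v \<in> I \<union> P" for v
    using that pg(3) hI hP by (auto simp: x_def)
  have row: "rigidity_row S T p e (Some i) = rigidity_row s t x e i" if "e \<in> E" "i \<in> I" for e i
  proof -
    have "Some i = h v \<longleftrightarrow> i = v" if "v \<in> I \<union> P" for v
      using that hI hP \<open>i \<in> I\<close> pg(3) by (cases "v \<in> P") auto
    then show ?thesis using endsIP[OF that(1)] by (simp add: edge_row_def S_def T_def xh)
  qed
  have "row_indep I (E - {e}) (rigidity_row s t x)" if "e \<in> E" for e
  proof -
    have "row_indep I (E - {e}) (\<lambda>c i. rigidity_row S T p c (Some i))"
      using p(1) that by (simp add: row_indep_def)
    then show ?thesis by (subst (asm) row_indep_cong[OF row]) auto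
  qed
  then show ?thesis using p(2) by (intro that[of x]) (auto simp: x_def)
qed

section \<open>Separating the pins while keeping the rotation as a motion\<close>

theorem theorem3p3:
  fixes I P :: "'v set" and E :: "'v set set"
  assumes "assur_graph I P E"
  shows "\<exists>p :: 'v \<Rightarrow> real^2. inj_on p P \<and>
    (\<exists>\<omega>. self_stress I P E p \<omega> \<and> (\<forall>e\<in>E. \<omega> e \<noteq> 0) \<and>
        (\<forall>w. self_stress I P E p w \<longrightarrow> (\<exists>c::real. w = (\<lambda>e. c * \<omega> e)))) \<and>
    (\<exists>q. first_order_motion I P E p q \<and> q \<noteq> (\<lambda>v. 0) \<and> (\<forall>i\<in>I. q i \<noteq> 0) \<and>
        (\<forall>q'. first_order_motion I P E p q' \<longrightarrow> (\<exists>c::real. q' = (\<lambda>v. c *\<^sub>R q v))))"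
proof -
  have pg: "finite I" "finite P" "I \<inter> P = {}" "finite E" "\<And>e. e \<in> E \<Longrightarrow> card e = 2"
    and cardE: "card E = 2 * card I"
    using assms by (auto simp: assur_graph_def pinned_isostatic_def pinned_graph_def)
  have "rigidity_circuit E (\<lambda>e. identify_pins P ` e)" using assms by (simp add: assur_graph_def)
  then have "E \<noteq> {}" by (auto simp: rigidity_circuit_def mg_vertices_def)
  then obtain e0 where e0: "e0 \<in> E" by blast
  have "I \<noteq> {}" using cardE \<open>E \<noteq> {}\<close> pg(4) by auto
  have "\<forall>e\<in>E. \<exists>a b. e = {a, b} \<and> a \<noteq> b" using pg(5) by (meson card_2_iff)
  then obtain s t where st: "\<And>e. e \<in> E \<Longrightarrow> e = {s e, t e} \<and> s e \<noteq> t e" by metis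
  obtain x :: "'v \<Rightarrow> real^2" where x: "\<forall>v. v \<notin> I \<longrightarrow> x v = 0" "\<forall>i\<in>I. x i \<noteq> 0"
    "\<forall>e\<in>E. row_indep I (E - {e}) (rigidity_row s t x)"
    using assur_graph_coincident_pins[OF assms, of s t] st by blast
  define q where "q = perp \<circ> x"
  have q: "\<forall>v. v \<notin> I \<longrightarrow> q v = 0" "\<forall>i\<in>I. q i \<noteq> 0" using x by (auto simp: q_def)
  have q_diff: "q u - q v = perp (x u - x v)" for u v
    by (simp add: q_def linear_diff[OF linear_perp])
  have card_E: "card E = DIM(real^2) * card I" using cardE by simp
  \<comment> \<open>Applied twice: with \<open>g\<close> as \<open>q\<close>, where the kernel is
    spanned by \<open>x\<close>, and with \<open>g\<close> as the final \<open>p\<close>, where it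
    is spanned by \<open>q\<close>.\<close>
  have unique_kernel: "\<exists>a. \<forall>k\<in>I. y k = a *\<^sub>R z k"
    if "row_indep I (E - {e0}) (rigidity_row s t g)"
      "\<forall>v. v \<notin> I \<longrightarrow> y v = 0" "\<forall>e\<in>E. (g (s e) - g (t e)) \<bullet> (y (s e) - y (t e)) = 0"
      "\<forall>v. v \<notin> I \<longrightarrow> z v = 0" "\<forall>e\<in>E. (g (s e) - g (t e)) \<bullet> (z (s e) - z (t e)) = 0" "\<forall>i\<in>I. z i \<noteq> 0"
    for g y z :: "'v \<Rightarrow> real^2"
  proof -
    have z: "\<forall>c\<in>E-{e0}. (\<Sum>k\<in>I. rigidity_row s t g c k \<bullet> z k) = 0"
      and y: "\<forall>c\<in>E-{e0}. (\<Sum>k\<in>I. rigidity_row s t g c k \<bullet> y k) = 0"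
      using that by (simp_all add: sum_edge_row_inner[OF pg(1)])
    have "\<exists>k\<in>I. z k \<noteq> 0" using that(6) \<open>I \<noteq> {}\<close> by blast
    from row_indep_almost_square_kernel[OF pg(1,4) card_E e0 that(1) z this y] show ?thesis by blast
  qed
  have ind_q: "row_indep I (E - {e0}) (rigidity_row s t q)"
  proof -
    have "row_indep I (E - {e0}) (\<lambda>e i. perp (rigidity_row s t x e i))"
      using row_indep_linear_image[OF x(3)[rule_format, OF e0] linear_perp] by simp
    moreover have "perp (rigidity_row s t x e i) = rigidity_row s t q e i" for e i
      by (simp add: edge_row_def q_diff linear_scale[OF linear_perp])
    ultimately show ?thesis by simp
  qed
  \<comment> \<open>Freeing the pin \<open>a\<close> gives \<open>2 * card I + 2\<close> unknowns
    against \<open>card E + 1\<close> equations. A solution with \<open>r a = 0\<close> would be a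
    multiple of \<open>x\<close> and orthogonal to \<open>x\<close>, hence zero.\<close>
  have pin: "\<exists>r::'v \<Rightarrow> real^2. r a \<noteq> 0 \<and> (\<forall>b\<in>P-{a}. r b = 0) \<and>
      (\<forall>e\<in>E. (q (s e) - q (t e)) \<bullet> (r (s e) - r (t e)) = 0)" if a: "a \<in> P" for a
  proof -
    \<comment> \<open>The index \<open>{}\<close>, which is no edge, carries the extra equation that excludes the rotation \<open>x\<close>.\<close>
    define A where "A = (\<lambda>e. if e = {} then x else rigidity_row s t q e)"
    have aI: "a \<notin> I" using a pg(3) by blast
    have "{} \<notin> E" using pg(5) by fastforce
    then have "card (insert {} E) < DIM(real^2) * card (insert a I)"
      using aI pg(1,4) cardE by simp
    then obtain r where r: "\<exists>k\<in>insert a I. r k \<noteq> 0" "\<forall>k. k \<notin> insert a I \<longrightarrow> r k = 0"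
        "\<forall>c\<in>insert {} E. (\<Sum>k\<in>insert a I. A c k \<bullet> r k) = 0"
      using nontrivial_kernel[of "insert a I" "insert {} E" A] pg(1,4) by blast
    have eqs: "(q (s e) - q (t e)) \<bullet> (r (s e) - r (t e)) = 0" if "e \<in> E" for e
    proof -
      have "A e = rigidity_row s t q e" using that \<open>{} \<notin> E\<close> by (auto simp: A_def)
      moreover have "(\<Sum>k\<in>insert a I. A e k \<bullet> r k) = 0" using r(3) that by blast
      ultimately show ?thesis using sum_edge_row_inner[OF _ r(2), of s t] pg(1) by simp
    qed
    have orth: "(\<Sum>k\<in>I. x k \<bullet> r k) = 0" using r(3) aI pg(1) x(1) by (simp add: A_def)
    have "r a \<noteq> 0"
    proof
      assume ra: "r a = 0"
      have "\<forall>e\<in>E. (q (s e) - q (t e)) \<bullet> (x (s e) - x (t e)) = 0"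
        by (simp add: q_diff inner_commute)
      moreover have "\<forall>v. v \<notin> I \<longrightarrow> r v = 0" using r(2) ra by auto
      ultimately obtain c where c: "\<forall>k\<in>I. r k = c *\<^sub>R x k"
        using unique_kernel[OF ind_q, of r x] eqs x(1,2) by blast
      have "c * (\<Sum>k\<in>I. x k \<bullet> x k) = 0" using orth c by (simp add: sum_distrib_left)
      moreover have "(\<Sum>k\<in>I. x k \<bullet> x k) \<noteq> 0"
        using x(2) \<open>I \<noteq> {}\<close> pg(1) by (subst sum_nonneg_eq_0_iff) auto
      ultimately show False using r(1) ra c by auto
    qed
    then show ?thesis using eqs r(2) pg(3) by (intro exI[of _ r]) blast
  qed
  then obtain R :: "'v \<Rightarrow> 'v \<Rightarrow> real^2" where R: "\<And>a. a \<in> P \<Longrightarrow> R a a \<noteq> 0"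
      "\<And>a b. a \<in> P \<Longrightarrow> b \<in> P \<Longrightarrow> b \<noteq> a \<Longrightarrow> R a b = 0"
      "\<And>a e. a \<in> P \<Longrightarrow> e \<in> E \<Longrightarrow> (q (s e) - q (t e)) \<bullet> (R a (s e) - R a (t e)) = 0"
    by (metis Diff_iff singletonD)
  obtain g :: "'v \<Rightarrow> nat" where g: "inj_on g P"
    using finite_imp_inj_to_nat_seg[OF pg(2)] by blast
  \<comment> \<open>The weights give the pin \<open>b\<close> the norm
    \<open>1 + real (g b)\<close>, so distinct pins have distinct norms.\<close>
  define r where "r = (\<lambda>v. \<Sum>a\<in>P. ((1 + real (g a)) / norm (R a a)) *\<^sub>R R a v)"
  have norm_r: "norm (r b) = 1 + real (g b)" if "b \<in> P" for b
  proof -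
    have "r b = (\<Sum>a\<in>{b}. ((1 + real (g a)) / norm (R a a)) *\<^sub>R R a b)"
      unfolding r_def using that R(2) pg(2) by (intro sum.mono_neutral_right) auto
    then show ?thesis using R(1)[OF that] by simp
  qed
  have r_eqs: "(q (s e) - q (t e)) \<bullet> (r (s e) - r (t e)) = 0" if "e \<in> E" for e
  proof -
    have "r (s e) - r (t e) = (\<Sum>a\<in>P. ((1 + real (g a)) / norm (R a a)) *\<^sub>R (R a (s e) - R a (t e)))"
      by (simp add: r_def sum_subtractf scaleR_diff_right)
    then show ?thesis using R(3) that by (simp add: inner_sum_right)
  qed
  define Q where "Q = (\<lambda>p::'v \<Rightarrow> real^2. \<forall>e\<in>E. row_indep I (E - {e}) (rigidity_row s t p))"
  have gen: "line_generic Q"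
    unfolding Q_def using pg(4) x(3) by (intro line_generic_finite_Ball(1) line_generic_rigidity_row) auto
  have "Q x" using x(3) by (simp add: Q_def)
  \<comment> \<open>The line from \<open>x\<close> to \<open>x + r\<close> is parametrised by the
    points \<open>x + \<tau> r\<close>.\<close>
  from line_genericD[of Q x "\<lambda>v. x v + r v", OF gen this]
  have "finite {\<tau>. \<not> Q (\<lambda>v. (1 - \<tau>) *\<^sub>R x v + \<tau> *\<^sub>R (x v + r v))}"
    .
  moreover have "(1 - \<tau>) *\<^sub>R x v + \<tau> *\<^sub>R (x v + r v) = x v + \<tau> *\<^sub>R r v" for \<tau> v
    by (simp add: algebra_simps)
  \<comment> \<open>The value 0 is excluded because all pins coincide there.\<close>
  ultimately have "finite (insert 0 {\<tau>. \<not> Q (\<lambda>v. x v + \<tau> *\<^sub>R r v)})" by simp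
  from ex_new_if_finite[OF infinite_UNIV_char_0 this]
  obtain \<tau> where \<tau>: "\<tau> \<noteq> 0" "Q (\<lambda>v. x v + \<tau> *\<^sub>R r v)" by auto
  define p where "p = (\<lambda>v. x v + \<tau> *\<^sub>R r v)"
  have ind_p: "row_indep I (E - {e}) (rigidity_row s t p)" if "e \<in> E" for e
    using \<tau>(2) that unfolding Q_def p_def by blast
  have "inj_on p P"
  proof (rule inj_onI)
    fix a b assume ab: "a \<in> P" "b \<in> P" "p a = p b"
    have "x a = 0" "x b = 0" using ab x(1) pg(3) by blast+
    then have "r a = r b" using ab(3) \<tau>(1) by (simp add: p_def)
    then have "g a = g b" using norm_r[OF ab(1)] norm_r[OF ab(2)] by simp
    then show "a = b" using g ab by (simp add: inj_on_eq_iff)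
  qed
  \<comment> \<open>The condition splits linearly in \<open>p\<close>: the \<open>x\<close> part
    vanishes since velocities are quarter turns of positions, the \<open>r\<close> part by the
    choice of \<open>r\<close>.\<close>
  have pq: "(p (s e) - p (t e)) \<bullet> (q (s e) - q (t e)) = 0" if "e \<in> E" for e
  proof -
    have "(p (s e) - p (t e)) \<bullet> (q (s e) - q (t e)) =
        (x (s e) - x (t e)) \<bullet> (q (s e) - q (t e)) + \<tau> * ((q (s e) - q (t e)) \<bullet> (r (s e) - r (t e)))"
      by (simp add: p_def algebra_simps inner_commute)
    then show ?thesis using r_eqs[OF that] by (simp add: q_diff)
  qed
  have motion: "first_order_motion I P E p z \<longleftrightarrow> (\<forall>v. v \<notin> I \<longrightarrow> z v = 0) \<and>
     (\<forall>e\<in>E. (p (s e) - p (t e)) \<bullet> (z (s e) - z (t e)) = 0)" for z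
    using st by (intro first_order_motion_iff) blast
  have motion_unique: "\<exists>c. z = (\<lambda>v. c *\<^sub>R q v)" if "first_order_motion I P E p z" for z
  proof -
    have z: "\<forall>v. v \<notin> I \<longrightarrow> z v = 0" "\<forall>e\<in>E. (p (s e) - p (t e)) \<bullet> (z (s e) - z (t e)) = 0"
      using that unfolding motion by simp_all
    have "\<forall>e\<in>E. (p (s e) - p (t e)) \<bullet> (q (s e) - q (t e)) = 0" using pq by simp
    from unique_kernel[OF ind_p[OF e0] z q(1) this q(2)]
    obtain c where c: "\<forall>k\<in>I. z k = c *\<^sub>R q k" by (elim exE)
    have "z v = c *\<^sub>R q v" for v
      using c z(1) q(1) by (cases "v \<in> I") simp_all
    then show ?thesis by blast
  qed
  have motion_q: "first_order_motion I P E p q" using q(1) pq unfolding motion by simp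
  have q_nz: "q \<noteq> (\<lambda>v. 0)" using q(2) \<open>I \<noteq> {}\<close> by auto
  \<comment> \<open>The matrix is square and has \<open>q\<close> in its kernel, so a self-stress
    exists.\<close>
  have dep: "\<not> row_indep I E (rigidity_row s t p)"
  proof
    assume ind: "row_indep I E (rigidity_row s t p)"
    have "\<forall>e\<in>E. (\<Sum>k\<in>I. rigidity_row s t p e k \<bullet> q k) = 0"
      using pq by (simp add: sum_edge_row_inner[OF pg(1) q(1)])
    from row_indep_square_kernel[OF pg(1,4) card_E ind this]
    have "q i = 0" if "i \<in> I" for i using that by simp
    then show False using q(2) \<open>I \<noteq> {}\<close> by blast
  qed
  obtain w where w: "\<forall>e. e \<notin> E \<longrightarrow> w e = 0" "\<forall>i\<in>I. (\<Sum>e\<in>E. w e *\<^sub>R rigidity_row s t p e i) = 0"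
    "\<forall>e\<in>E. w e \<noteq> 0"
    "\<And>u. \<forall>e. e \<notin> E \<longrightarrow> u e = 0 \<Longrightarrow> \<forall>i\<in>I. (\<Sum>e\<in>E. u e *\<^sub>R rigidity_row s t p e i) = 0 \<Longrightarrow>
       \<exists>a. u = (\<lambda>e. a * w e)"
    using row_dependency_of_circuit[OF pg(4) \<open>E \<noteq> {}\<close> dep ind_p] by blast
  have stress: "self_stress I P E p u \<longleftrightarrow> (\<forall>e. e \<notin> E \<longrightarrow> u e = 0) \<and>
     (\<forall>i\<in>I. (\<Sum>e\<in>E. u e *\<^sub>R rigidity_row s t p e i) = 0)" for u
    by (rule self_stress_iff[OF st pg(4)])
  have "self_stress I P E p w" using w(1,2) unfolding stress by (rule conjI)
  moreover have "\<exists>c. u = (\<lambda>e. c * w e)" if "self_stress I P E p u" for u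
    using that w(4)[of u] unfolding stress by (elim conjE)
  ultimately have "\<exists>\<omega>. self_stress I P E p \<omega> \<and> (\<forall>e\<in>E. \<omega> e \<noteq> 0) \<and>
      (\<forall>u. self_stress I P E p u \<longrightarrow> (\<exists>c. u = (\<lambda>e. c * \<omega> e)))"
    using w(3) by (intro exI[of _ w] conjI allI impI)
  moreover have "\<exists>q. first_order_motion I P E p q \<and> q \<noteq> (\<lambda>v. 0) \<and> (\<forall>i\<in>I. q i \<noteq> 0) \<and>
      (\<forall>z. first_order_motion I P E p z \<longrightarrow> (\<exists>c. z = (\<lambda>v. c *\<^sub>R q v)))"
    using motion_q q_nz q(2) motion_unique by (intro exI[of _ q] conjI allI impI)
  ultimately show ?thesis using \<open>inj_on p P\<close> by - (rule exI[of _ p], intro conjI)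
qed

end
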